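(* Let $\kappa:\mathbb{R}^p\times\mathbb{R}^p\to\mathbb{R}$ be a symmetric positive semidefinite kernel function, let $\mathbf{x}_1,\ldots,\mathbf{x}_n\in\mathbb{R}^p$ be data points and let $\mathbf{z}_1,\ldots,\mathbf{z}_m\in\mathbb{R}^p$ be arbitrary landmark points, with $r\le m\le n$. Let $\mathbf{C}\in\mathbb{R}^{n\times m}$ and $\mathbf{W}\in\mathbb{R}^{m\times m}$ be given by $C_{ij}=\kappa(\mathbf{x}_i,\mathbf{z}_j)$ and $W_{ij}=\kappa(\mathbf{z}_i,\mathbf{z}_j)$. Let $\mathbf{C}=\mathbf{Q}\mathbf{R}$ be a thin QR decomposition of $\mathbf{C}$, and let $\mathbf{R}\mathbf{W}^{\dagger}\mathbf{R}^T=\mathbf{V}'\boldsymbol{\Sigma}'\mathbf{V}'^T$ be an eigenvalue decomposition with $\mathbf{V}'\in\mathbb{R}^{m\times m}$ orthogonal and $\boldsymbol{\Sigma}'\in\mathbb{R}^{m\times m}$ diagonal with diagonal entries in descending order. Let $\mathbf{V}'_r\in\mathbb{R}^{m\times r}$ consist of the first $r$ columns of $\mathbf{V}'$ and let $\boldsymbol{\Sigma}'_r\in\mathbb{R}^{r\times r}$ be the leading $r\times r$ diagonal block of $\boldsymbol{\Sigma}'$. Then $$\mathbf{G}^{opt}_{(r)}:=(\mathbf{Q}\mathbf{V}'_r)\,\boldsymbol{\Sigma}'_r\,(\mathbf{Q}\mathbf{V}'_r)^T$$ is a best rank-$r$ approximation of the Nystr\"om approximation $\mathbf{C}\mathbf{W}^{\dagger}\mathbf{C}^T$,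 i.e. $\mathbf{G}^{opt}_{(r)}$ has rank at most $r$ and $$\|\mathbf{C}\mathbf{W}^{\dagger}\mathbf{C}^T-\mathbf{G}^{opt}_{(r)}\|_F=\min_{\mathbf{G}'\in\mathbb{R}^{n\times n}:\ \mathrm{rank}(\mathbf{G}')\le r}\|\mathbf{C}\mathbf{W}^{\dagger}\mathbf{C}^T-\mathbf{G}'\|_F .$$
   Context: A kernel function $\kappa$ is symmetric positive semidefinite if for every finite set of points the matrix of its pairwise values is symmetric positive semidefinite. $\|\cdot\|_F$ is the Frobenius norm and $\mathbf{W}^{\dagger}$ is the Moore–Penrose pseudo-inverse. A thin QR decomposition of $\mathbf{C}\in\mathbb{R}^{n\times m}$ ($n\ge m$) is a factorization $\mathbf{C}=\mathbf{Q}\mathbf{R}$ with $\mathbf{Q}\in\mathbb{R}^{n\times m}$, $\mathbf{Q}^T\mathbf{Q}=\mathbf{I}_{m\times m}$, and $\mathbf{R}\in\mathbb{R}^{m\times m}$ upper triangular. *)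

theory Defs
  imports Complex_Main "Jordan_Normal_Form.DL_Rank"
begin

abbreviation mat_rank :: "real mat \<Rightarrow> nat" where
  "mat_rank A \<equiv> vec_space.rank (dim_row A) A"

definition frobenius_norm :: "real mat \<Rightarrow> real" where
  "frobenius_norm A = sqrt (\<Sum>i<dim_row A. \<Sum>j<dim_col A. (A $$ (i, j))\<^sup>2)"

definition sym_psd_mat :: "real mat \<Rightarrow> bool" where
  "sym_psd_mat A \<longleftrightarrow> square_mat A \<and> A\<^sup>T = A \<and>
     (\<forall>v \<in> carrier_vec (dim_row A). v \<bullet> (A *\<^sub>v v) \<ge> 0)"

(* A finite set of points is given by a duplicate-free enumeration of it. Only values
   of the kernel on carrier_vec p, i.e. R^p, matter. *)
definition sym_psd_kernel :: "nat \<Rightarrow> (real vec \<Rightarrow> real vec \<Rightarrow> real) \<Rightarrow> bool" where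
  "sym_psd_kernel p \<kappa> \<longleftrightarrow>
     (\<forall>ps. distinct ps \<and> set ps \<subseteq> carrier_vec p \<longrightarrow>
        sym_psd_mat (mat (length ps) (length ps) (\<lambda>(i, j). \<kappa> (ps ! i) (ps ! j))))"

(* The four Penrose conditions. *)
definition is_pseudo_inverse :: "real mat \<Rightarrow> real mat \<Rightarrow> bool" where
  "is_pseudo_inverse A X \<longleftrightarrow> X \<in> carrier_mat (dim_col A) (dim_row A) \<and>
     A * X * A = A \<and> X * A * X = X \<and> (A * X)\<^sup>T = A * X \<and> (X * A)\<^sup>T = X * A"

definition pseudo_inverse :: "real mat \<Rightarrow> real mat" where
  "pseudo_inverse A = (THE X. is_pseudo_inverse A X)"

definition thin_QR :: "real mat \<Rightarrow> real mat \<Rightarrow> real mat \<Rightarrow> bool" where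
  "thin_QR C Q R \<longleftrightarrow> dim_col C \<le> dim_row C \<and>
     Q \<in> carrier_mat (dim_row C) (dim_col C) \<and> R \<in> carrier_mat (dim_col C) (dim_col C) \<and>
     C = Q * R \<and> Q\<^sup>T * Q = 1\<^sub>m (dim_col C) \<and> upper_triangular R"

(* The library's orthogonal_mat only asks for pairwise orthogonal nonzero columns,
   so V V^T = V^T V = I is required explicitly. *)
definition descending_eigen_decomp :: "real mat \<Rightarrow> real mat \<Rightarrow> real mat \<Rightarrow> bool" where
  "descending_eigen_decomp A V S \<longleftrightarrow>
     V \<in> carrier_mat (dim_row A) (dim_row A) \<and> S \<in> carrier_mat (dim_row A) (dim_row A) \<and>
     V\<^sup>T * V = 1\<^sub>m (dim_row A) \<and> V * V\<^sup>T = 1\<^sub>m (dim_row A) \<and>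
     diagonal_mat S \<and> (\<forall>i j. i \<le> j \<and> j < dim_row A \<longrightarrow> S $$ (j, j) \<le> S $$ (i, i)) \<and>
     A = V * S * V\<^sup>T"

definition best_rank_approx :: "nat \<Rightarrow> real mat \<Rightarrow> real mat \<Rightarrow> bool" where
  "best_rank_approx r A G \<longleftrightarrow>
     G \<in> carrier_mat (dim_row A) (dim_col A) \<and> mat_rank G \<le> r \<and>
     (\<forall>G' \<in> carrier_mat (dim_row A) (dim_col A). mat_rank G' \<le> r \<longrightarrow>
        frobenius_norm (A - G) \<le> frobenius_norm (A - G'))"

end

theory Submission
  imports Defs "Jordan_Normal_Form.Gram_Schmidt"
begin

text \<open>The kernel makes \<open>W\<close>, hence \<open>W\<^sup>\<dagger>\<close> and \<open>R W\<^sup>\<dagger> R\<^sup>T\<close>, positive semidefinite, so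
  \<open>C W\<^sup>\<dagger> C\<^sup>T = U \<Sigma>' U\<^sup>T\<close> with \<open>U = Q V'\<close> having orthonormal columns and \<open>\<Sigma>'\<close> nonnegative and
  descending, i.e. a singular value decomposition, and the best approximation of rank \<open>r\<close> is its
  truncation. The Eckart--Young bound needs only Gram--Schmidt and Bessel: a competitor of rank
  \<open>k \<le> r\<close> is \<open>P Y\<close> with \<open>P\<close> having \<open>k\<close> orthonormal columns, so its
  squared distance from \<open>A\<close> is at least \<open>\<parallel>A\<parallel>\<^sup>2 - \<parallel>P\<^sup>T A\<parallel>\<^sup>2\<close>, and \<open>\<parallel>P\<^sup>T A\<parallel>\<^sup>2\<close> is a weighted sum of
  the squared singular values with weights in \<open>[0, 1]\<close> of total mass at most \<open>r\<close>.
  Gram--Schmidt also yields \<open>W\<^sup>\<dagger>\<close>: the orthogonal projection onto the range of \<open>W\<close> is \<open>W B\<close> for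
  some \<open>B\<close>, and then \<open>W\<^sup>\<dagger> = B\<^sup>T W B\<close>.\<close>

section \<open>Frobenius norm, isometries and Bessel's inequality\<close>

lemma frobenius_norm_sq: "(frobenius_norm A)\<^sup>2 = (\<Sum>j<dim_col A. col A j \<bullet> col A j)"
proof -
  have "(frobenius_norm A)\<^sup>2 = (\<Sum>i<dim_row A. \<Sum>j<dim_col A. (A $$ (i, j))\<^sup>2)"
    unfolding frobenius_norm_def by (simp add: sum_nonneg)
  also have "\<dots> = (\<Sum>j<dim_col A. \<Sum>i<dim_row A. (A $$ (i, j))\<^sup>2)"
    by (rule sum.swap)
  also have "\<dots> = (\<Sum>j<dim_col A. col A j \<bullet> col A j)"
    by (intro sum.cong refl) (auto simp: scalar_prod_def power2_eq_square lessThan_atLeast0)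
  finally show ?thesis .
qed

lemma frobenius_norm_nonneg: "0 \<le> frobenius_norm A"
  unfolding frobenius_norm_def by (simp add: sum_nonneg)

lemma frobenius_norm_transpose: "frobenius_norm A\<^sup>T = frobenius_norm A"
proof -
  have "(\<Sum>i<dim_col A. \<Sum>j<dim_row A. (A\<^sup>T $$ (i, j))\<^sup>2) =
        (\<Sum>i<dim_col A. \<Sum>j<dim_row A. (A $$ (j, i))\<^sup>2)"
    by (intro sum.cong refl) auto
  also have "\<dots> = (\<Sum>i<dim_row A. \<Sum>j<dim_col A. (A $$ (i, j))\<^sup>2)"
    by (rule sum.swap)
  finally show ?thesis unfolding frobenius_norm_def by simp
qed

lemma isometry_scalar_prod:
  fixes U :: "real mat"
  assumes U: "U \<in> carrier_mat n k" "U\<^sup>T * U = 1\<^sub>m k" and v: "v \<in> carrier_vec k" "w \<in> carrier_vec k"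
  shows "(U *\<^sub>v v) \<bullet> (U *\<^sub>v w) = v \<bullet> w"
proof -
  have "(U *\<^sub>v v) \<bullet> (U *\<^sub>v w) = (U\<^sup>T *\<^sub>v (U *\<^sub>v v)) \<bullet> w"
    by (rule transpose_vec_mult_scalar[symmetric]) (use U v in auto)
  also have "U\<^sup>T *\<^sub>v (U *\<^sub>v v) = (U\<^sup>T * U) *\<^sub>v v"
    by (rule assoc_mult_mat_vec[symmetric]) (use U v in auto)
  also have "\<dots> = v" using U v by simp
  finally show ?thesis .
qed

lemma frobenius_norm_isometry_left:
  assumes U: "U \<in> carrier_mat n k" "U\<^sup>T * U = 1\<^sub>m k" and M: "M \<in> carrier_mat k l"
  shows "frobenius_norm (U * M) = frobenius_norm M"
proof -
  have "(frobenius_norm (U * M))\<^sup>2 = (frobenius_norm M)\<^sup>2"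
    unfolding frobenius_norm_sq
  proof (rule sum.cong)
    fix j assume "j \<in> {..<dim_col M}"
    then have j: "j < l" using M by simp
    have "col (U * M) j = U *\<^sub>v col M j" by (rule col_mult2[OF U(1) M j])
    then show "col (U * M) j \<bullet> col (U * M) j = col M j \<bullet> col M j"
      using isometry_scalar_prod[OF U, of "col M j" "col M j"] M j by simp
  qed (use M in auto)
  then show ?thesis using frobenius_norm_nonneg by (simp add: power2_eq_iff_nonneg)
qed

lemma frobenius_norm_isometry_right:
  assumes U: "U \<in> carrier_mat n k" "U\<^sup>T * U = 1\<^sub>m k" and M: "M \<in> carrier_mat l k"
  shows "frobenius_norm (M * U\<^sup>T) = frobenius_norm M"
proof -
  have "frobenius_norm (M * U\<^sup>T) = frobenius_norm (M * U\<^sup>T)\<^sup>T"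
    by (rule frobenius_norm_transpose[symmetric])
  also have "(M * U\<^sup>T)\<^sup>T = U * M\<^sup>T"
    using U M by (subst transpose_mult[of _ l k _ n]) auto
  also have "frobenius_norm \<dots> = frobenius_norm M"
    using frobenius_norm_isometry_left[OF U, of "M\<^sup>T" l] M frobenius_norm_transpose by simp
  finally show ?thesis .
qed

text \<open>Complete the square: with \<open>b = P\<^sup>T *\<^sub>v a\<close>, the squared distance
  equals |a|^2 - |b|^2 + |b - y|^2, and only the last term depends on \<open>y\<close>.\<close>

lemma orthonormal_cols_dist_ge:
  fixes P :: "real mat"
  assumes P: "P \<in> carrier_mat n k" "P\<^sup>T * P = 1\<^sub>m k"
    and a: "a \<in> carrier_vec n" and y: "y \<in> carrier_vec k"
  shows "a \<bullet> a - (P\<^sup>T *\<^sub>v a) \<bullet> (P\<^sup>T *\<^sub>v a) \<le> (a - P *\<^sub>v y) \<bullet> (a - P *\<^sub>v y)"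
proof -
  define b where "b = P\<^sup>T *\<^sub>v a"
  have b: "b \<in> carrier_vec k" unfolding b_def using P a by (auto intro: mult_mat_vec_carrier)
  have Py: "P *\<^sub>v y \<in> carrier_vec n" using P y by auto
  have ba: "a \<bullet> (P *\<^sub>v y) = b \<bullet> y"
    unfolding b_def by (rule transpose_vec_mult_scalar[symmetric]) (use P a y in auto)
  have "(a - P *\<^sub>v y) \<bullet> (a - P *\<^sub>v y) = a \<bullet> a - 2 * (a \<bullet> (P *\<^sub>v y)) + (P *\<^sub>v y) \<bullet> (P *\<^sub>v y)"
    using a Py comm_scalar_prod[OF Py a]
    by (simp add: minus_scalar_prod_distrib[of _ n] scalar_prod_minus_distrib[of _ n])
  also have "\<dots> = a \<bullet> a - b \<bullet> b + (b - y) \<bullet> (b - y)"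
    using b y comm_scalar_prod[OF y b] isometry_scalar_prod[OF P y y] ba
    by (simp add: minus_scalar_prod_distrib[of _ k] scalar_prod_minus_distrib[of _ k])
  finally have "(a - P *\<^sub>v y) \<bullet> (a - P *\<^sub>v y) = a \<bullet> a - b \<bullet> b + (b - y) \<bullet> (b - y)" .
  moreover have "(b - y) \<bullet> (b - y) \<ge> 0"
    unfolding scalar_prod_def by (intro sum_nonneg) auto
  ultimately show ?thesis unfolding b_def by simp
qed

text \<open>The residual of \<open>a\<close> after projection onto the columns of \<open>P\<close>
  has squared norm |a|^2 - |b|^2, where \<open>b = P\<^sup>T *\<^sub>v a\<close>; a squared norm is
  nonnegative.\<close>

lemma bessel_ineq:
  fixes P :: "real mat"
  assumes P: "P \<in> carrier_mat n k" "P\<^sup>T * P = 1\<^sub>m k" and a: "a \<in> carrier_vec n"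
  shows "(P\<^sup>T *\<^sub>v a) \<bullet> (P\<^sup>T *\<^sub>v a) \<le> a \<bullet> a"
proof -
  let ?b = "P\<^sup>T *\<^sub>v a"
  have b: "?b \<in> carrier_vec k" using P a by (auto intro: mult_mat_vec_carrier)
  have Pb: "P *\<^sub>v ?b \<in> carrier_vec n" using P b by auto
  have "?b \<bullet> ?b = a \<bullet> (P *\<^sub>v ?b)"
    by (rule transpose_vec_mult_scalar) (use P a b in auto)
  moreover have "(a - P *\<^sub>v ?b) \<bullet> (a - P *\<^sub>v ?b) = a \<bullet> a - 2 * (a \<bullet> (P *\<^sub>v ?b)) + (P *\<^sub>v ?b) \<bullet> (P *\<^sub>v ?b)"
    using a Pb comm_scalar_prod[OF Pb a]
    by (simp add: minus_scalar_prod_distrib[of _ n] scalar_prod_minus_distrib[of _ n])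
  moreover have "(P *\<^sub>v ?b) \<bullet> (P *\<^sub>v ?b) = ?b \<bullet> ?b"
    by (rule isometry_scalar_prod[OF P b b])
  moreover have "(a - P *\<^sub>v ?b) \<bullet> (a - P *\<^sub>v ?b) \<ge> 0"
    unfolding scalar_prod_def by (intro sum_nonneg) auto
  ultimately show ?thesis by simp
qed

lemma frobenius_norm_bessel:
  assumes P: "P \<in> carrier_mat n k" "P\<^sup>T * P = 1\<^sub>m k" and A: "A \<in> carrier_mat n l"
  shows "(frobenius_norm (P\<^sup>T * A))\<^sup>2 \<le> (frobenius_norm A)\<^sup>2"
proof -
  have "col (P\<^sup>T * A) j = P\<^sup>T *\<^sub>v col A j" if "j < l" for j
    using P A that by (intro col_mult2) auto
  then show ?thesis
    unfolding frobenius_norm_sq using A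
    by (auto intro!: sum_mono bessel_ineq[OF P])
qed

lemma frobenius_norm_orthonormal:
  assumes P: "P \<in> carrier_mat n k" "P\<^sup>T * P = 1\<^sub>m k"
  shows "(frobenius_norm P)\<^sup>2 = real k"
proof -
  have "col P j \<bullet> col P j = 1" if "j < k" for j
  proof -
    have "col P j \<bullet> col P j = (P\<^sup>T * P) $$ (j, j)" using P(1) that by simp
    then show ?thesis using P(2) that by simp
  qed
  then show ?thesis unfolding frobenius_norm_sq using P by simp
qed

text \<open>The vector estimate summed over columns. The lower bound is free of \<open>Y\<close>, so
  it holds at once for all matrices whose columns lie in the span of those of
  \<open>P\<close>.\<close>

lemma frobenius_norm_diff_ge:
  assumes P: "P \<in> carrier_mat n k" "P\<^sup>T * P = 1\<^sub>m k" and A: "A \<in> carrier_mat n l" and Y: "Y \<in> carrier_mat k l"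
  shows "(frobenius_norm A)\<^sup>2 - (frobenius_norm (P\<^sup>T * A))\<^sup>2 \<le> (frobenius_norm (A - P * Y))\<^sup>2"
proof -
  have "col (P\<^sup>T * A) j = P\<^sup>T *\<^sub>v col A j" if "j < l" for j
    using P A that by (intro col_mult2) auto
  moreover have "col (A - P * Y) j = col A j - P *\<^sub>v col Y j" if "j < l" for j
  proof -
    have "col (P * Y) j = P *\<^sub>v col Y j" using P Y that by (intro col_mult2) auto
    moreover have "col (A - P * Y) j = col A j - col (P * Y) j" using P A Y that by (intro eq_vecI) auto
    ultimately show ?thesis by simp
  qed
  ultimately show ?thesis
    unfolding frobenius_norm_sq using A P Y
    by (auto simp: sum_subtractf[symmetric] intro!: sum_mono orthonormal_cols_dist_ge[OF P])
qed

section \<open>Orthonormal bases of column spaces, and rank\<close>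

lemma exists_right_factor:
  fixes A B :: "real mat"
  assumes A: "A \<in> carrier_mat n a" and B: "B \<in> carrier_mat n b"
    and cols: "\<And>j. j < a \<Longrightarrow> \<exists>v \<in> carrier_vec b. B *\<^sub>v v = col A j"
  shows "\<exists>X \<in> carrier_mat b a. A = B * X"
proof -
  obtain f where f: "f j \<in> carrier_vec b" "B *\<^sub>v f j = col A j" if "j < a" for j
    using cols by metis
  define X where "X = mat_of_cols b (map f [0..<a])"
  have X: "X \<in> carrier_mat b a" unfolding X_def by (simp add: mat_of_cols_def)
  have "col X j = f j" if "j < a" for j
    unfolding X_def using that f by (subst col_mat_of_cols) auto
  then have "col A j = col (B * X) j" if "j < a" for j
    using that f(2) col_mult2[OF B X that] by metis
  then have "A = B * X"
    using A B X by (intro mat_col_eqI) simp_all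
  then show ?thesis using X by blast
qed

text \<open>Gram-Schmidt on a maximal independent set of columns. The two factorizations express
  equality of column spaces: \<open>A = P * Y\<close> puts competitors of bounded rank into the form
  needed for the distance bound, while \<open>P = A * B\<close> supplies the factor from which the
  pseudo-inverse is built.\<close>

lemma orthonormal_col_basis:
  fixes A :: "real mat"
  assumes A: "A \<in> carrier_mat n l"
  obtains P Y B where "P \<in> carrier_mat n (mat_rank A)" "P\<^sup>T * P = 1\<^sub>m (mat_rank A)"
    "Y \<in> carrier_mat (mat_rank A) l" "A = P * Y" "B \<in> carrier_mat l (mat_rank A)" "P = A * B"
proof -
  interpret cof_vec_space n "TYPE(real)" .
  have cA: "set (cols A) \<subseteq> carrier_vec n" using A cols_dim by blast
  \<comment> \<open>Maximality serves twice: \<open>rank_card_indpt\<close> makes the size of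
    \<open>S\<close> the rank, and no column can lie outside the span of \<open>S\<close>.\<close>
  obtain S where S: "maximal S (\<lambda>T. T \<subseteq> set (cols A) \<and> lin_indpt T)"
    using maximal_exists[of "(\<lambda>T. T \<subseteq> set (cols A) \<and> lin_indpt T)" "card (set (cols A))" "{}"]
    by (meson List.finite_set card_mono empty_iff empty_subsetI finite_lin_indpt2 rev_finite_subset)
  then have S_cols: "S \<subseteq> set (cols A)" and ind: "lin_indpt S" by (auto simp: maximal_def)
  have S_car: "S \<subseteq> carrier_vec n" using S_cols cA by blast
  obtain ws where ws: "set ws = S" "distinct ws"
    using finite_distinct_list[of S] S_cols finite_subset by blast
  define k where "k = length ws"
  have rank: "mat_rank A = k"
    using rank_card_indpt[OF A S] ws distinct_card[of ws] A by (simp add: k_def)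
  define us where "us = gram_schmidt n ws"
  have us: "span S = span (set us)" "corthogonal us" "set us \<subseteq> carrier_vec n" "length us = k"
    using gram_schmidt_result[of ws us] ws S_car ind by (auto simp: us_def k_def)
  have cols_span: "set (cols A) \<subseteq> span S"
  proof
    fix c assume c: "c \<in> set (cols A)"
    show "c \<in> span S"
    proof (rule ccontr)
      assume nc: "c \<notin> span S"
      then have "c \<notin> S" using S_car in_own_span by auto
      then have "lin_indpt (insert c S)"
        using nc lin_dep_iff_in_span[OF S_car ind, of c] c cA by auto
      then show False using S c S_cols \<open>c \<notin> S\<close> unfolding maximal_def by blast
    qed
  qed
  define U where "U = mat_of_cols n us"
  have U: "U \<in> carrier_mat n k" unfolding U_def using us by auto
  have colU: "cols U = us" unfolding U_def using us by (simp add: cols_mat_of_cols)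
  have "\<exists>v \<in> carrier_vec k. U *\<^sub>v v = col A j" if "j < l" for j
  proof -
    have "col A j \<in> set (cols A)" using A that by (simp add: cols_def)
    then have "col A j \<in> col_space U" using cols_span us colU unfolding col_space_def by auto
    then show ?thesis using col_space_eq[OF U] U by auto
  qed
  then obtain Y0 where Y0: "Y0 \<in> carrier_mat k l" "A = U * Y0"
    using exists_right_factor[OF A U] by auto
  have "\<exists>v \<in> carrier_vec l. A *\<^sub>v v = col U j" if "j < k" for j
  proof -
    have "col U j \<in> set us" using colU U that by (metis carrier_matD(2) cols_length cols_nth nth_mem)
    then have "col U j \<in> span S" using us(1) in_own_span[OF us(3)] by auto
    then have "col U j \<in> col_space A"
      using span_is_monotone[OF S_cols] unfolding col_space_def by auto
    then show ?thesis using col_space_eq[OF A] A by auto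
  qed
  then obtain B0 where B0: "B0 \<in> carrier_mat l k" "U = A * B0"
    using exists_right_factor[OF U A] by auto
  \<comment> \<open>\<open>gram_schmidt\<close> returns orthogonal vectors of arbitrary nonzero
    length. \<open>D\<close> normalizes them and \<open>D'\<close> undoes this, so \<open>D'\<close>
    is absorbed into the coefficients of \<open>A\<close>.\<close>
  define c where "c j = sqrt (us ! j \<bullet> us ! j)" for j
  define D where "D = mat k k (\<lambda>(i, j). if i = j then 1 / c i else 0)"
  define D' where "D' = mat k k (\<lambda>(i, j). if i = j then c i else 0)"
  have D: "D \<in> carrier_mat k k" "D' \<in> carrier_mat k k" by (auto simp: D_def D'_def)
  \<comment> \<open>\<open>corthogonal\<close> is phrased with conjugates, which are trivial over
    the reals.\<close>
  have conj: "conjugate v = v" for v :: "real vec" by (intro eq_vecI) auto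
  have orth: "us ! i \<bullet> us ! j = 0 \<longleftrightarrow> i \<noteq> j" if "i < k" "j < k" for i j
    using corthogonalD[OF us(2), of i j] that us(4) by (simp add: conj)
  have nonneg: "0 \<le> v \<bullet> v" for v :: "real vec"
    unfolding scalar_prod_def by (intro sum_nonneg) auto
  have c: "c i * c i = us ! i \<bullet> us ! i" "c i \<noteq> 0" if "i < k" for i
    using orth[OF that that] nonneg[of "us ! i"] unfolding c_def by auto
  have DD': "D * D' = 1\<^sub>m k"
    by (intro eq_matI)
      (auto simp: D_def D'_def scalar_prod_def c if_distrib[of "\<lambda>x. x * _"] cong: if_cong)
  define P where "P = U * D"
  have P: "P \<in> carrier_mat n k" unfolding P_def using U D by auto
  have P_col: "col P j = (1 / c j) \<cdot>\<^sub>v us ! j" if j: "j < k" for j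
  proof (intro eq_vecI)
    fix i assume "i < dim_vec ((1 / c j) \<cdot>\<^sub>v us ! j)"
    moreover have uj: "us ! j \<in> carrier_vec n" using us j nth_mem by blast
    ultimately have i: "i < n" using uj by simp
    have "U $$ (i, x) = us ! x $ i" if "x < k" for x
      unfolding U_def using that i us by (simp add: mat_of_cols_index)
    then show "col P j $ i = ((1 / c j) \<cdot>\<^sub>v us ! j) $ i"
      using i j U uj
      by (auto simp: P_def D_def scalar_prod_def if_distrib[of "\<lambda>x. _ * x"] cong: if_cong)
  qed (use us j P nth_mem[of j us] in fastforce)
  have orthP: "P\<^sup>T * P = 1\<^sub>m k"
  proof (intro eq_matI)
    fix i j assume "i < dim_row (1\<^sub>m k :: real mat)" "j < dim_col (1\<^sub>m k :: real mat)"
    then have ij: "i < k" "j < k" by auto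
    then have car: "us ! i \<in> carrier_vec n" "us ! j \<in> carrier_vec n" using us nth_mem by auto
    have "(P\<^sup>T * P) $$ (i, j) = col P i \<bullet> col P j" using P ij by simp
    also have "\<dots> = (1 / c i) * ((1 / c j) * (us ! i \<bullet> us ! j))"
      using P_col ij car by simp
    also have "\<dots> = 1\<^sub>m k $$ (i, j)" using ij orth[OF ij] c by (auto simp: field_simps)
    finally show "(P\<^sup>T * P) $$ (i, j) = 1\<^sub>m k $$ (i, j)" .
  qed (use P in auto)
  have "P * (D' * Y0) = U * (D * D') * Y0"
    unfolding P_def using U D Y0 by (simp add: assoc_mult_mat[of _ n k _ k _ l] assoc_mult_mat[of _ n k _ k _ k] assoc_mult_mat[of _ k k _ k _ l])
  also have "\<dots> = A" unfolding DD' using U Y0 by simp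
  finally have AP: "A = P * (D' * Y0)" ..
  have PA: "P = A * (B0 * D)"
    unfolding P_def B0(2) using A B0 D by (simp add: assoc_mult_mat[of _ n l _ k _ k])
  show ?thesis
    by (rule that[unfolded rank, OF P orthP _ AP _ PA]) (use D Y0 B0 in auto)
qed

text \<open>The squared Frobenius norm of an orthonormal basis counts its vectors, so ranks can be
  compared as norms. The basis \<open>P'\<close> for \<open>A * B\<close> lies in the span of the
  basis \<open>P\<close> for \<open>A\<close>, and Bessel's inequality compares the two.\<close>

lemma mat_rank_mult_le:
  assumes A: "A \<in> carrier_mat n l" and B: "B \<in> carrier_mat l q"
  shows "mat_rank (A * B) \<le> mat_rank A"
proof -
  define k where "k = mat_rank A"
  define k' where "k' = mat_rank (A * B)"
  obtain P Y where P: "P \<in> carrier_mat n k" "P\<^sup>T * P = 1\<^sub>m k"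
    and Y: "Y \<in> carrier_mat k l" "A = P * Y"
    using orthonormal_col_basis[OF A] unfolding k_def by metis
  obtain P' B' where P': "P' \<in> carrier_mat n k'" "P'\<^sup>T * P' = 1\<^sub>m k'"
    and B': "B' \<in> carrier_mat q k'" "P' = A * B * B'"
    using orthonormal_col_basis[OF mult_carrier_mat[OF A B]] unfolding k'_def by metis
  define Z where "Z = Y * (B * B')"
  have Z: "Z \<in> carrier_mat k k'" unfolding Z_def using Y B B' by auto
  have P'_eq: "P' = P * Z"
    unfolding Z_def B'(2) Y(2) using P Y B B'
    by (simp add: assoc_mult_mat[of _ n k _ l _ q] assoc_mult_mat[of _ n k _ q _ k'] assoc_mult_mat[of _ k l _ q _ k'])
  have "P\<^sup>T * P' = P\<^sup>T * P * Z"
    unfolding P'_eq by (rule assoc_mult_mat[symmetric]) (use P Z in auto)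
  then have Z_eq: "Z = P\<^sup>T * P'" using P Z by simp
  have "real k' = (frobenius_norm P')\<^sup>2"
    using frobenius_norm_orthonormal[OF P'] by simp
  \<comment> \<open>The transpose matters: Bessel applied to \<open>P\<^sup>T * P'\<close> would
    bound it by the norm of \<open>P'\<close> again, whereas \<open>P'\<^sup>T * P\<close> is
    bounded by the norm of \<open>P\<close>.\<close>
  also have "\<dots> = (frobenius_norm Z\<^sup>T)\<^sup>2"
    unfolding P'_eq frobenius_norm_isometry_left[OF P Z] frobenius_norm_transpose ..
  also have "Z\<^sup>T = P'\<^sup>T * P"
    unfolding Z_eq using P P' by (subst transpose_mult[of _ k n]) auto
  also have "(frobenius_norm \<dots>)\<^sup>2 \<le> (frobenius_norm P)\<^sup>2"
    by (rule frobenius_norm_bessel[OF P' P(1)])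
  also have "\<dots> = real k" by (rule frobenius_norm_orthonormal[OF P])
  finally show ?thesis unfolding k_def k'_def by simp
qed

section \<open>Positive semidefinite matrices and the pseudo-inverse\<close>

text \<open>The quadratic form at \<open>v\<close> is that of \<open>K\<close> at
  \<open>E\<^sup>T *\<^sub>v v\<close>. This one fact carries positivity from the kernel on distinct
  points to \<open>W\<close>, its pseudo-inverse, \<open>R * X * R\<^sup>T\<close> and finally the
  eigenvalues.\<close>

lemma sym_psd_mat_congruence:
  assumes K: "K \<in> carrier_mat k k" "sym_psd_mat K" and E: "E \<in> carrier_mat m k"
  shows "sym_psd_mat (E * K * E\<^sup>T)"
  unfolding sym_psd_mat_def
proof (intro conjI ballI)
  show "square_mat (E * K * E\<^sup>T)" using E K by auto
  have KT: "K\<^sup>T = K" using K unfolding sym_psd_mat_def by auto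
  have "(E * K * E\<^sup>T)\<^sup>T = E * (E * K)\<^sup>T"
    using E K by (subst transpose_mult[of _ m k _ m]) auto
  also have "(E * K)\<^sup>T = K * E\<^sup>T"
    using E K KT by (subst transpose_mult[of _ m k _ k]) auto
  also have "E * (K * E\<^sup>T) = E * K * E\<^sup>T"
    by (rule assoc_mult_mat[symmetric]) (use E K in auto)
  finally show "(E * K * E\<^sup>T)\<^sup>T = E * K * E\<^sup>T" .
next
  fix v :: "real vec" assume "v \<in> carrier_vec (dim_row (E * K * E\<^sup>T))"
  then have v: "v \<in> carrier_vec m" using E by simp
  define u where "u = E\<^sup>T *\<^sub>v v"
  have u: "u \<in> carrier_vec k" unfolding u_def using E v by (auto intro: mult_mat_vec_carrier)
  have "(E * K * E\<^sup>T) *\<^sub>v v = E * K *\<^sub>v u"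
    unfolding u_def by (rule assoc_mult_mat_vec) (use E K v in auto)
  also have "\<dots> = E *\<^sub>v (K *\<^sub>v u)"
    by (rule assoc_mult_mat_vec) (use E K u in auto)
  finally have "v \<bullet> ((E * K * E\<^sup>T) *\<^sub>v v) = v \<bullet> (E *\<^sub>v (K *\<^sub>v u))" by simp
  also have "\<dots> = u \<bullet> (K *\<^sub>v u)"
    unfolding u_def[symmetric] using transpose_vec_mult_scalar[OF E _ v, of "K *\<^sub>v u"] K u
    by (simp add: u_def[symmetric] mult_mat_vec_carrier)
  also have "\<dots> \<ge> 0" using K u unfolding sym_psd_mat_def by auto
  finally show "0 \<le> v \<bullet> ((E * K * E\<^sup>T) *\<^sub>v v)" .
qed

lemma sym_psd_mat_diag_nonneg:
  assumes K: "K \<in> carrier_mat k k" "sym_psd_mat K" and i: "i < k"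
  shows "0 \<le> K $$ (i, i)"
proof -
  have "0 \<le> unit_vec k i \<bullet> (K *\<^sub>v unit_vec k i)"
    using K unfolding sym_psd_mat_def by auto
  also have "\<dots> = K $$ (i, i)"
    using K i by (simp add: mult_mat_vec_carrier)
  finally show ?thesis .
qed

text \<open>Symmetry of the projections forces A X = A Y and X A = Y A; then X = X A X = Y A X = Y A
  Y = Y. Uniqueness is what lets the definite description in \<open>pseudo_inverse\<close> be
  evaluated at an explicit witness.\<close>

lemma is_pseudo_inverse_unique:
  assumes "is_pseudo_inverse A X" and "is_pseudo_inverse A Y"
  shows "X = Y"
proof -
  define n where "n = dim_row A"
  define m where "m = dim_col A"
  have A: "A \<in> carrier_mat n m" by (simp add: n_def m_def)
  have X: "X \<in> carrier_mat m n" "A * X * A = A" "X * A * X = X" "(A * X)\<^sup>T = A * X" "(X * A)\<^sup>T = X * A"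
    and Y: "Y \<in> carrier_mat m n" "A * Y * A = A" "Y * A * Y = Y" "(A * Y)\<^sup>T = A * Y" "(Y * A)\<^sup>T = Y * A"
    using assms by (simp_all add: is_pseudo_inverse_def n_def m_def)
  have "A * X = (A * Y * A) * X" using Y by simp
  also have "\<dots> = (A * Y) * (A * X)"
    by (rule assoc_mult_mat) (use A X Y in auto)
  \<comment> \<open>Both factors are symmetric, so transposing their product only swaps them, after
    which \<open>A * X * A\<close> collapses to \<open>A\<close>.\<close>
  also have "\<dots> = ((A * X) * (A * Y))\<^sup>T"
    using A X Y by (subst transpose_mult[of _ n n _ n]) auto
  also have "(A * X) * (A * Y) = (A * X * A) * Y"
    by (rule assoc_mult_mat[symmetric]) (use A X Y in auto)
  finally have AX: "A * X = A * Y" using X Y by simp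
  have "X * A = X * (A * Y * A)" using Y by simp
  also have "\<dots> = (X * A) * (Y * A)"
    using A X Y by (simp add: assoc_mult_mat[of _ n m _ n _ m] assoc_mult_mat[of _ m n _ m _ m])
  also have "\<dots> = ((Y * A) * (X * A))\<^sup>T"
    using A X Y by (subst transpose_mult[of _ m m _ m]) auto
  also have "(Y * A) * (X * A) = Y * (A * X * A)"
    using A X Y by (simp add: assoc_mult_mat[of _ n m _ n _ m] assoc_mult_mat[of _ m n _ m _ m])
  finally have XA: "X * A = Y * A" using X Y by simp
  have "X = Y * (A * X)"
    using X XA assoc_mult_mat[OF Y(1) A X(1)] by simp
  also have "\<dots> = Y"
    unfolding AX using assoc_mult_mat[OF Y(1) A Y(1)] Y by simp
  finally show ?thesis .
qed

text \<open>The witness is \<open>X = E * B'\<close>, where \<open>E = W * B'\<close> projects onto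
  the range of \<open>W\<close>. Symmetry of \<open>W\<close> gives \<open>W * X = E\<close> and
  \<open>X * W = E\<close>, which reduces the Penrose conditions to properties of
  \<open>E\<close>.\<close>

lemma sym_psd_mat_pseudo_inverse:
  assumes W: "W \<in> carrier_mat m m" "sym_psd_mat W"
  shows "is_pseudo_inverse W (pseudo_inverse W)" and "sym_psd_mat (pseudo_inverse W)"
proof -
  obtain k P Y B where P: "P \<in> carrier_mat m k" "P\<^sup>T * P = 1\<^sub>m k"
    and Y: "Y \<in> carrier_mat k m" "W = P * Y" and B: "B \<in> carrier_mat m k" "P = W * B"
    using orthonormal_col_basis[OF W(1)] by metis
  have WT: "W\<^sup>T = W" using W unfolding sym_psd_mat_def by auto
  define B' where "B' = B * P\<^sup>T"
  \<comment> \<open>The orthogonal projection onto the range of \<open>W\<close>; it must equal \<open>W W\<^sup>\<dagger>\<close>.\<close>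
  define E where "E = P * P\<^sup>T"
  have B': "B' \<in> carrier_mat m m" and E: "E \<in> carrier_mat m m"
    unfolding B'_def E_def using B P by auto
  note assoc = assoc_mult_mat[of _ m m _ m _ m]
  have E_eq: "E = W * B'"
    unfolding E_def B'_def using assoc_mult_mat[OF W(1) B(1), of "P\<^sup>T" m] P(1) B(2) by simp
  have ET: "E\<^sup>T = E"
    unfolding E_def using P by (subst transpose_mult[of _ m k _ m]) auto
  have EP: "E * P = P"
    unfolding E_def using P by (simp add: assoc_mult_mat[of _ m k _ m _ k])
  have EW: "E * W = W"
    using assoc_mult_mat[OF E P(1) Y(1)] EP Y(2) by simp
  have EE: "E * E = E"
    using assoc_mult_mat[OF E P(1), of "P\<^sup>T" m] P(1) EP by (simp add: E_def)
  have WE: "W * E = W"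
    using transpose_mult[OF E W(1)] ET WT EW by simp
  define X where "X = E * B'"
  have X: "X \<in> carrier_mat m m" unfolding X_def using E B' by auto
  \<comment> \<open>Transposing \<open>E = W * B'\<close> turns \<open>X\<close> into a congruence
    of \<open>W\<close>, which makes it positive semidefinite.\<close>
  have "B'\<^sup>T * W = E"
    using transpose_mult[OF W(1) B'] ET WT E_eq by simp
  then have "X = B'\<^sup>T * W * (B'\<^sup>T)\<^sup>T" unfolding X_def by simp
  then have psd: "sym_psd_mat X"
    using sym_psd_mat_congruence[OF W, of "B'\<^sup>T" m] B' by simp
  then have XT: "X\<^sup>T = X" unfolding sym_psd_mat_def by simp
  have WX: "W * X = E"
    unfolding X_def using assoc_mult_mat[OF W(1) E B'] WE E_eq by simp
  have XW: "X * W = E"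
    using transpose_mult[OF W(1) X] XT WT ET WX by simp
  have "E * X = X"
    unfolding X_def using assoc_mult_mat[OF E E B'] EE by simp
  then have "is_pseudo_inverse W X"
    unfolding is_pseudo_inverse_def using W X WX XW EW ET by simp
  moreover from this have "pseudo_inverse W = X"
    unfolding pseudo_inverse_def by (blast intro: the_equality is_pseudo_inverse_unique)
  ultimately show "is_pseudo_inverse W (pseudo_inverse W)" "sym_psd_mat (pseudo_inverse W)"
    using psd by simp_all
qed

section \<open>Kernel matrices of arbitrary landmarks\<close>

lemma mult_transpose_mat_index:
  fixes X T :: "'a :: semiring_0 mat"
  assumes "X \<in> carrier_mat k m" "T \<in> carrier_mat l m" "i < k" "j < l"
  shows "(X * T\<^sup>T) $$ (i, j) = (\<Sum>a<m. X $$ (i, a) * T $$ (j, a))"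
  using assms by (auto simp: scalar_prod_def lessThan_atLeast0 intro!: sum.cong)

text \<open>The kernel condition speaks of distinct points only, while landmarks may repeat. The
  matrix is therefore obtained from that of the distinct points by a congruence that duplicates rows
  and columns.\<close>

lemma sym_psd_kernel_mat:
  assumes ker: "sym_psd_kernel p \<kappa>" and z: "\<And>j. j < m \<Longrightarrow> z j \<in> carrier_vec p"
  shows "sym_psd_mat (mat m m (\<lambda>(i, j). \<kappa> (z i) (z j)))"
proof -
  define ps where "ps = remdups (map z [0..<m])"
  define k where "k = length ps"
  define K where "K = mat k k (\<lambda>(i, j). \<kappa> (ps ! i) (ps ! j))"
  have K: "K \<in> carrier_mat k k" by (simp add: K_def)
  have "distinct ps" "set ps \<subseteq> carrier_vec p" using z by (auto simp: ps_def)
  then have psd: "sym_psd_mat K"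
    using ker unfolding sym_psd_kernel_def K_def k_def by blast
  have "\<exists>a<k. ps ! a = z j" if "j < m" for j
  proof -
    have "z j \<in> set ps" using that by (simp add: ps_def)
    then show ?thesis unfolding k_def by (simp add: in_set_conv_nth)
  qed
  then obtain f where f: "f j < k" "ps ! f j = z j" if "j < m" for j
    by metis
  \<comment> \<open>Row \<open>i\<close> is the unit vector at the position of \<open>z i\<close> in
    \<open>ps\<close>; equal landmarks get equal rows.\<close>
  define E where "E = mat m k (\<lambda>(i, a). if a = f i then 1 else 0 :: real)"
  have E: "E \<in> carrier_mat m k" by (simp add: E_def)
  have EK: "(E * K) $$ (i, b) = \<kappa> (z i) (ps ! b)" if "i < m" "b < k" for i b
    using that f[of i] by (simp add: E_def K_def scalar_prod_def if_distrib[of "\<lambda>x. x * _"] cong: if_cong)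
  have "mat m m (\<lambda>(i, j). \<kappa> (z i) (z j)) = E * K * E\<^sup>T"
  proof (intro eq_matI)
    fix i j assume "i < dim_row (E * K * E\<^sup>T)" "j < dim_col (E * K * E\<^sup>T)"
    then have ij: "i < m" "j < m" using E by auto
    have "(E * K * E\<^sup>T) $$ (i, j) = (\<Sum>b<k. (E * K) $$ (i, b) * E $$ (j, b))"
      using mult_transpose_mat_index[of "E * K" m k E m i j] ij E K by simp
    also have "\<dots> = (\<Sum>b<k. if b = f j then \<kappa> (z i) (ps ! b) else 0)"
      using ij by (intro sum.cong refl) (auto simp: EK, auto simp: E_def)
    also have "\<dots> = \<kappa> (z i) (z j)" using f ij by simp
    finally show "mat m m (\<lambda>(i, j). \<kappa> (z i) (z j)) $$ (i, j) = (E * K * E\<^sup>T) $$ (i, j)"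
      using ij by simp
  qed (use E in auto)
  then show ?thesis using sym_psd_mat_congruence[OF K psd E] by simp
qed

section \<open>Products with diagonal matrices\<close>

lemma mult_diagonal_mat_index:
  fixes T D :: "real mat"
  assumes T: "T \<in> carrier_mat k m" and D: "D \<in> carrier_mat m m" "diagonal_mat D"
    and ij: "i < k" "j < m"
  shows "(T * D) $$ (i, j) = T $$ (i, j) * D $$ (j, j)"
proof -
  have "(T * D) $$ (i, j) = (\<Sum>a<m. T $$ (i, a) * D $$ (a, j))"
    using assms by (auto simp: scalar_prod_def lessThan_atLeast0 intro!: sum.cong)
  also have "\<dots> = (\<Sum>a<m. if a = j then T $$ (i, a) * D $$ (a, a) else 0)"
    using assms by (intro sum.cong refl) (auto simp: diagonal_mat_def)
  also have "\<dots> = T $$ (i, j) * D $$ (j, j)" using ij by simp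
  finally show ?thesis .
qed

lemma diagonal_congruence_index:
  fixes T D :: "real mat"
  assumes T: "T \<in> carrier_mat k m" and D: "D \<in> carrier_mat m m" "diagonal_mat D"
    and ij: "i < k" "j < k"
  shows "(T * D * T\<^sup>T) $$ (i, j) = (\<Sum>a<m. T $$ (i, a) * D $$ (a, a) * T $$ (j, a))"
proof -
  have "(T * D * T\<^sup>T) $$ (i, j) = (\<Sum>a<m. (T * D) $$ (i, a) * T $$ (j, a))"
    using mult_transpose_mat_index[of "T * D" k m T k i j] T D(1) ij by simp
  then show ?thesis using mult_diagonal_mat_index[OF T D ij(1)] by simp
qed

lemma frobenius_norm_mult_diagonal:
  assumes T: "T \<in> carrier_mat k m" and D: "D \<in> carrier_mat m m" "diagonal_mat D"
  shows "(frobenius_norm (T * D))\<^sup>2 = (\<Sum>j<m. (D $$ (j, j))\<^sup>2 * (col T j \<bullet> col T j))"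
  unfolding frobenius_norm_sq
proof (rule sum.cong)
  fix j assume "j \<in> {..<m}"
  then have j: "j < m" by simp
  have "col (T * D) j = D $$ (j, j) \<cdot>\<^sub>v col T j"
  proof (rule eq_vecI)
    fix i assume "i < dim_vec (D $$ (j, j) \<cdot>\<^sub>v col T j)"
    then have i: "i < k" using T by simp
    have "col (T * D) j $ i = (T * D) $$ (i, j)" using T D(1) i j by (intro index_col) auto
    then show "col (T * D) j $ i = (D $$ (j, j) \<cdot>\<^sub>v col T j) $ i"
      using T i j mult_diagonal_mat_index[OF T D i j] by simp
  qed (use T in simp)
  then show "col (T * D) j \<bullet> col (T * D) j = (D $$ (j, j))\<^sup>2 * (col T j \<bullet> col T j)"
    by (simp add: power2_eq_square)
qed (use T D in auto)

lemma frobenius_norm_diagonal: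
  assumes D: "D \<in> carrier_mat m m" "diagonal_mat D"
  shows "(frobenius_norm D)\<^sup>2 = (\<Sum>j<m. (D $$ (j, j))\<^sup>2)"
  using frobenius_norm_mult_diagonal[OF one_carrier_mat D] D(1) by simp

section \<open>The Eckart-Young bound\<close>

text \<open>After subtracting the threshold \<open>d\<close>, each of the first \<open>r\<close>
  terms is largest at weight 1 and each later one at weight 0. Since \<open>d\<close> is
  nonnegative, the bound on the total weight allows it to be added back. For \<open>r = m\<close> no
  entry lies beyond the top ones and \<open>d = 0\<close> suffices.\<close>

lemma weighted_sum_le_top_sum:
  fixes c t :: "nat \<Rightarrow> real"
  assumes r: "r \<le> m"
    and c: "\<And>j. j < m \<Longrightarrow> 0 \<le> c j" "\<And>i j. i \<le> j \<Longrightarrow> j < m \<Longrightarrow> c j \<le> c i"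
    and t: "\<And>j. j < m \<Longrightarrow> 0 \<le> t j" "\<And>j. j < m \<Longrightarrow> t j \<le> 1" "(\<Sum>j<m. t j) \<le> real r"
  shows "(\<Sum>j<m. c j * t j) \<le> (\<Sum>j<r. c j)"
proof -
  \<comment> \<open>A threshold \<open>d\<close> separating the top \<open>r\<close> entries from the others.\<close>
  define d where "d = (if r < m then c r else 0)"
  have d: "0 \<le> d" using c by (simp add: d_def)
  have "(c j - d) * t j \<le> (if j < r then c j - d else 0)" if j: "j < m" for j
  proof (cases "j < r")
    case True
    then have "0 \<le> c j - d" using c j by (auto simp: d_def)
    then show ?thesis using True mult_left_mono[OF t(2)[OF j], of "c j - d"] by simp
  next
    case False
    then have "c j - d \<le> 0" using c j by (auto simp: d_def)
    then show ?thesis using False t(1)[OF j] by (simp add: mult_nonpos_nonneg)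
  qed
  then have "(\<Sum>j<m. (c j - d) * t j) \<le> (\<Sum>j<m. if j < r then c j - d else 0)"
    by (intro sum_mono) auto
  also have "\<dots> = (\<Sum>j\<in>{j \<in> {..<m}. j < r}. c j - d)"
    by (rule sum.inter_filter[symmetric]) simp
  also have "{j \<in> {..<m}. j < r} = {..<r}" using r by auto
  finally have "(\<Sum>j<m. c j * t j) - d * (\<Sum>j<m. t j) \<le> (\<Sum>j<r. c j) - real r * d"
    by (simp add: left_diff_distrib sum_subtractf sum_distrib_left)
  moreover have "d * (\<Sum>j<m. t j) \<le> d * real r" using d t(3) by (rule mult_left_mono[rotated])
  ultimately show ?thesis by (simp add: mult.commute)
qed

text \<open>For \<open>P\<close> with orthonormal columns, the weights \<open>t\<^sub>j = \<parallel>P\<^sup>T u\<^sub>j\<parallel>\<^sup>2\<close> are at most \<open>1\<close> and sum to at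
  most \<open>k\<close>, both by Bessel's inequality.\<close>
lemma frobenius_norm_projection_le:
  assumes U: "U \<in> carrier_mat n m" "U\<^sup>T * U = 1\<^sub>m m"
    and S: "S \<in> carrier_mat m m" "diagonal_mat S"
    and desc: "\<And>i j. i \<le> j \<Longrightarrow> j < m \<Longrightarrow> (S $$ (j, j))\<^sup>2 \<le> (S $$ (i, i))\<^sup>2"
    and P: "P \<in> carrier_mat n k" "P\<^sup>T * P = 1\<^sub>m k" and k: "k \<le> r" and r: "r \<le> m"
  shows "(frobenius_norm (P\<^sup>T * (U * S * U\<^sup>T)))\<^sup>2 \<le> (\<Sum>j<r. (S $$ (j, j))\<^sup>2)"
proof -
  define T where "T = P\<^sup>T * U"
  have T: "T \<in> carrier_mat k m" unfolding T_def using P U by auto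
  have "P\<^sup>T * (U * S * U\<^sup>T) = P\<^sup>T * (U * S) * U\<^sup>T"
    by (rule assoc_mult_mat[symmetric]) (use P U S in auto)
  also have "P\<^sup>T * (U * S) = T * S"
    unfolding T_def by (rule assoc_mult_mat[symmetric]) (use P U S in auto)
  finally have "frobenius_norm (P\<^sup>T * (U * S * U\<^sup>T)) = frobenius_norm (T * S)"
    using frobenius_norm_isometry_right[OF U, of "T * S" k] T S by simp
  then have "(frobenius_norm (P\<^sup>T * (U * S * U\<^sup>T)))\<^sup>2 = (\<Sum>j<m. (S $$ (j, j))\<^sup>2 * (col T j \<bullet> col T j))"
    using frobenius_norm_mult_diagonal[OF T S] by simp
  also have "\<dots> \<le> (\<Sum>j<r. (S $$ (j, j))\<^sup>2)"
  proof (rule weighted_sum_le_top_sum[OF r _ desc])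
    show "0 \<le> col T j \<bullet> col T j" for j
      unfolding scalar_prod_def by (intro sum_nonneg) auto
    show "col T j \<bullet> col T j \<le> 1" if j: "j < m" for j
    proof -
      have "col T j = P\<^sup>T *\<^sub>v col U j"
        unfolding T_def using P U j by (intro col_mult2) auto
      then have "col T j \<bullet> col T j \<le> col U j \<bullet> col U j"
        using bessel_ineq[OF P, of "col U j"] U j by auto
      also have "\<dots> = (U\<^sup>T * U) $$ (j, j)" using U(1) j by simp
      also have "\<dots> = 1" using U(2) j by simp
      finally show ?thesis .
    qed
    \<comment> \<open>Summing the individual bounds would give only \<open>m\<close>. Transposing
      lets Bessel be applied with \<open>U\<close> to the columns of \<open>P\<close>, which gives
      \<open>k\<close>.\<close>
    have "(\<Sum>j<m. col T j \<bullet> col T j) = (frobenius_norm T\<^sup>T)\<^sup>2"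
      unfolding frobenius_norm_transpose frobenius_norm_sq using T by simp
    also have "T\<^sup>T = U\<^sup>T * P"
      unfolding T_def using P U by (subst transpose_mult[of _ k n]) auto
    also have "(frobenius_norm \<dots>)\<^sup>2 \<le> (frobenius_norm P)\<^sup>2"
      by (rule frobenius_norm_bessel[OF U P(1)])
    also have "\<dots> \<le> real r" using frobenius_norm_orthonormal[OF P] k by simp
    finally show "(\<Sum>j<m. col T j \<bullet> col T j) \<le> real r" .
  qed auto
  finally show ?thesis .
qed

text \<open>Both sides are compared with |A|^2 minus the sum of the \<open>r\<close> largest squared
  diagonal entries: the truncation attains this value, and writing \<open>G' = P * Y\<close> shows
  that no competitor goes below it.\<close>

lemma eckart_young:
  assumes U: "U \<in> carrier_mat n m" "U\<^sup>T * U = 1\<^sub>m m"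
    and S: "S \<in> carrier_mat m m" "diagonal_mat S"
    and desc: "\<And>i j. i \<le> j \<Longrightarrow> j < m \<Longrightarrow> (S $$ (j, j))\<^sup>2 \<le> (S $$ (i, i))\<^sup>2"
    and r: "r \<le> m"
    and S': "S' = mat m m (\<lambda>(i, j). if i < r then S $$ (i, j) else 0)"
    and G': "G' \<in> carrier_mat n n" "mat_rank G' \<le> r"
  shows "frobenius_norm (U * S * U\<^sup>T - U * S' * U\<^sup>T) \<le> frobenius_norm (U * S * U\<^sup>T - G')"
proof (rule power2_le_imp_le[OF _ frobenius_norm_nonneg])
  define A where "A = U * S * U\<^sup>T"
  have A: "A \<in> carrier_mat n n" unfolding A_def using U S by auto
  have S'_car: "S' \<in> carrier_mat m m" by (simp add: S')
  have norm_congr: "frobenius_norm (U * M * U\<^sup>T) = frobenius_norm M" if "M \<in> carrier_mat m m" for M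
    using frobenius_norm_isometry_right[OF U, of "U * M" n] frobenius_norm_isometry_left[OF U that] U that
    by simp
  have "U * S * U\<^sup>T - U * S' * U\<^sup>T = (U * S - U * S') * U\<^sup>T"
    by (rule minus_mult_distrib_mat[symmetric]) (use U S S'_car in auto)
  also have "U * S - U * S' = U * (S - S')"
    by (rule mult_minus_distrib_mat[symmetric]) (use U S S'_car in auto)
  finally have "(frobenius_norm (U * S * U\<^sup>T - U * S' * U\<^sup>T))\<^sup>2 = (frobenius_norm (S - S'))\<^sup>2"
    using norm_congr[OF minus_carrier_mat[OF S'_car]] by simp
  also have "\<dots> = (\<Sum>j<m. ((S - S') $$ (j, j))\<^sup>2)"
    using S S'_car by (intro frobenius_norm_diagonal) (auto simp: S' diagonal_mat_def)
  also have "\<dots> = (\<Sum>j<m. (S $$ (j, j))\<^sup>2 - (if j < r then (S $$ (j, j))\<^sup>2 else 0))"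
    using S by (intro sum.cong refl) (auto simp: S')
  also have "\<dots> = (\<Sum>j<m. (S $$ (j, j))\<^sup>2) - (\<Sum>j\<in>{j \<in> {..<m}. j < r}. (S $$ (j, j))\<^sup>2)"
    by (simp only: sum_subtractf sum.inter_filter finite_lessThan)
  also have "{j \<in> {..<m}. j < r} = {..<r}" using r by auto
  also have "(\<Sum>j<m. (S $$ (j, j))\<^sup>2) = (frobenius_norm A)\<^sup>2"
    unfolding A_def norm_congr[OF S(1)] frobenius_norm_diagonal[OF S] ..
  finally have eq: "(frobenius_norm (U * S * U\<^sup>T - U * S' * U\<^sup>T))\<^sup>2 =
    (frobenius_norm A)\<^sup>2 - (\<Sum>j<r. (S $$ (j, j))\<^sup>2)" .
  obtain P Y where P: "P \<in> carrier_mat n (mat_rank G')" "P\<^sup>T * P = 1\<^sub>m (mat_rank G')"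
    and Y: "Y \<in> carrier_mat (mat_rank G') n" "G' = P * Y"
    using orthonormal_col_basis[OF G'(1)] by metis
  have "(frobenius_norm (P\<^sup>T * A))\<^sup>2 \<le> (\<Sum>j<r. (S $$ (j, j))\<^sup>2)"
    unfolding A_def by (rule frobenius_norm_projection_le[OF U S desc P G'(2) r])
  moreover have "(frobenius_norm A)\<^sup>2 - (frobenius_norm (P\<^sup>T * A))\<^sup>2 \<le> (frobenius_norm (A - G'))\<^sup>2"
    using frobenius_norm_diff_ge[OF P A Y(1)] Y(2) by simp
  ultimately show "(frobenius_norm (U * S * U\<^sup>T - U * S' * U\<^sup>T))\<^sup>2 \<le> (frobenius_norm (U * S * U\<^sup>T - G'))\<^sup>2"
    unfolding eq A_def by simp
qed

section \<open>The Nystrom approximation and its truncation\<close>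

theorem mainTheorem1:
  fixes n m r p :: nat
    and \<kappa> :: "real vec \<Rightarrow> real vec \<Rightarrow> real"
    and x z :: "nat \<Rightarrow> real vec"
    and C W Q R V S Vr Sr G :: "real mat"
  assumes "r \<le> m" and "m \<le> n"
    and "sym_psd_kernel p \<kappa>"
    and "\<And>i. i < n \<Longrightarrow> x i \<in> carrier_vec p"
    and "\<And>j. j < m \<Longrightarrow> z j \<in> carrier_vec p"
    and "C = mat n m (\<lambda>(i, j). \<kappa> (x i) (z j))"
    and "W = mat m m (\<lambda>(i, j). \<kappa> (z i) (z j))"
    and "thin_QR C Q R"
    and "descending_eigen_decomp (R * pseudo_inverse W * R\<^sup>T) V S"
    and "Vr = mat m r (\<lambda>(i, j). V $$ (i, j))"
    and "Sr = mat r r (\<lambda>(i, j). S $$ (i, j))"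
    and "G = (Q * Vr) * Sr * (Q * Vr)\<^sup>T"
  shows "best_rank_approx r (C * pseudo_inverse W * C\<^sup>T) G"
proof -
  note C = assms(6) and W = assms(7) and Vr = assms(10) and Sr = assms(11) and G = assms(12)
  have C_car: "C \<in> carrier_mat n m" and W_car: "W \<in> carrier_mat m m"
    using C W by simp_all
  have Q: "Q \<in> carrier_mat n m" "Q\<^sup>T * Q = 1\<^sub>m m" and R: "R \<in> carrier_mat m m" and CQR: "C = Q * R"
    using assms(8) C_car unfolding thin_QR_def by simp_all
  define X where "X = pseudo_inverse W"
  have W_psd: "sym_psd_mat W"
    unfolding W by (rule sym_psd_kernel_mat[OF assms(3) assms(5)])
  have X_psd: "sym_psd_mat X" and X: "X \<in> carrier_mat m m"
    using sym_psd_mat_pseudo_inverse[OF W_car W_psd] W_car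
    unfolding X_def is_pseudo_inverse_def by simp_all
  define M where "M = R * X * R\<^sup>T"
  have M: "M \<in> carrier_mat m m" unfolding M_def using R X by simp
  have M_psd: "sym_psd_mat M" unfolding M_def by (rule sym_psd_mat_congruence[OF X X_psd R])
  have V: "V \<in> carrier_mat m m" "V\<^sup>T * V = 1\<^sub>m m"
    and S: "S \<in> carrier_mat m m" "diagonal_mat S"
    and desc: "\<And>i j. i \<le> j \<Longrightarrow> j < m \<Longrightarrow> S $$ (j, j) \<le> S $$ (i, i)"
    and MV: "M = V * S * V\<^sup>T"
    using assms(9) M unfolding descending_eigen_decomp_def M_def X_def by auto

  \<comment> \<open>Inverting the eigenvalue decomposition exhibits \<open>S\<close> as a congruence
    of \<open>M\<close>, so the eigenvalues are nonnegative.\<close>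
  have "V\<^sup>T * M * (V\<^sup>T)\<^sup>T = V\<^sup>T * (V * S * V\<^sup>T * V)"
    unfolding MV using V(1) S(1) by (simp add: assoc_mult_mat[of _ m m _ m _ m])
  also have "V * S * V\<^sup>T * V = V * S * (V\<^sup>T * V)"
    by (rule assoc_mult_mat) (use V S in auto)
  also have "\<dots> = V * S" using V S by simp
  also have "V\<^sup>T * (V * S) = V\<^sup>T * V * S"
    by (rule assoc_mult_mat[symmetric]) (use V S in auto)
  also have "\<dots> = S" using V S by simp
  finally have "sym_psd_mat S"
    using sym_psd_mat_congruence[OF M M_psd, of "V\<^sup>T" m] V(1) by simp
  then have S_nonneg: "0 \<le> S $$ (j, j)" if "j < m" for j
    using sym_psd_mat_diag_nonneg[OF S(1)] that by blast
  \<comment> \<open>Nonnegativity is essential here: a negative eigenvalue of large modulus would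
    come last in \<open>S\<close> but first in the order of squares.\<close>
  have desc_sq: "(S $$ (j, j))\<^sup>2 \<le> (S $$ (i, i))\<^sup>2" if "i \<le> j" "j < m" for i j
    using desc[OF that] S_nonneg[OF that(2)] by (rule power_mono)

  define U where "U = Q * V"
  have U: "U \<in> carrier_mat n m" unfolding U_def using Q V by simp
  have UT: "U\<^sup>T = V\<^sup>T * Q\<^sup>T" unfolding U_def by (rule transpose_mult[OF Q(1) V(1)])
  have "U\<^sup>T * U = V\<^sup>T * (Q\<^sup>T * (Q * V))"
    unfolding UT unfolding U_def by (rule assoc_mult_mat) (use Q V in auto)
  also have "Q\<^sup>T * (Q * V) = Q\<^sup>T * Q * V"
    by (rule assoc_mult_mat[symmetric]) (use Q V in auto)
  finally have UTU: "U\<^sup>T * U = 1\<^sub>m m" using Q V by simp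

  define A where "A = C * X * C\<^sup>T"
  have "A = Q * R * X * (R\<^sup>T * Q\<^sup>T)"
    unfolding A_def CQR transpose_mult[OF Q(1) R] ..
  also have "\<dots> = Q * M * Q\<^sup>T"
    unfolding M_def using Q(1) R X
    by (simp add: assoc_mult_mat[of _ n m _ m _ m] assoc_mult_mat[of _ n m _ m _ n] assoc_mult_mat[of _ m m _ m _ m]
        assoc_mult_mat[of _ m m _ m _ n])
  also have "\<dots> = U * S * U\<^sup>T"
    unfolding MV UT unfolding U_def using Q(1) V(1) S(1)
    by (simp add: assoc_mult_mat[of _ n m _ m _ m] assoc_mult_mat[of _ n m _ m _ n] assoc_mult_mat[of _ m m _ m _ m]
        assoc_mult_mat[of _ m m _ m _ n])
  finally have A_eq: "A = U * S * U\<^sup>T" .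
  have A: "A \<in> carrier_mat n n" unfolding A_eq using U S by simp

  \<comment> \<open>\<open>Sr\<close> padded with zeros, so that \<open>G\<close> and
    \<open>A\<close> become congruences by the same \<open>U\<close>; the extra columns of
    \<open>U\<close> meet zero entries only.\<close>
  define S' where "S' = mat m m (\<lambda>(i, j). if i < r then S $$ (i, j) else 0)"
  have S': "S' \<in> carrier_mat m m" "diagonal_mat S'"
    using S by (auto simp: S'_def diagonal_mat_def)
  define N where "N = Q * Vr"
  have N: "N \<in> carrier_mat n r" unfolding N_def using Q Vr by simp
  have Sr_diag: "Sr \<in> carrier_mat r r" "diagonal_mat Sr"
    using Sr S assms(1) by (auto simp: diagonal_mat_def)
  have N_U: "N $$ (i, a) = U $$ (i, a)" if "i < n" "a < r" for i a
  proof -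
    have "col Vr a = col V a" using that Vr V(1) assms(1) by (intro eq_vecI) auto
    then show ?thesis using that Q(1) V(1) Vr assms(1) by (simp add: N_def U_def)
  qed
  have G_N: "G = N * Sr * N\<^sup>T" using G by (simp add: N_def)
  have G_car: "G \<in> carrier_mat n n" unfolding G_N using N Sr_diag by simp
  have G_eq: "G = U * S' * U\<^sup>T"
  proof (rule eq_matI)
    fix i j assume "i < dim_row (U * S' * U\<^sup>T)" "j < dim_col (U * S' * U\<^sup>T)"
    then have ij: "i < n" "j < n" using U by auto
    have "G $$ (i, j) = (\<Sum>a<r. N $$ (i, a) * Sr $$ (a, a) * N $$ (j, a))"
      unfolding G_N by (rule diagonal_congruence_index[OF N Sr_diag ij])
    also have "\<dots> = (\<Sum>a<r. U $$ (i, a) * S' $$ (a, a) * U $$ (j, a))"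
      using ij assms(1) by (intro sum.cong refl) (simp add: N_U Sr S'_def)
    also have "\<dots> = (\<Sum>a<m. U $$ (i, a) * S' $$ (a, a) * U $$ (j, a))"
      using assms(1) by (intro sum.mono_neutral_left) (auto simp: S'_def)
    also have "\<dots> = (U * S' * U\<^sup>T) $$ (i, j)"
      by (rule diagonal_congruence_index[OF U S' ij, symmetric])
    finally show "G $$ (i, j) = (U * S' * U\<^sup>T) $$ (i, j)" .
  qed (use G_car U in auto)

  \<comment> \<open>The rank bound comes from the left factor \<open>N\<close>, which has only
    \<open>r\<close> columns.\<close>
  have "G = N * (Sr * N\<^sup>T)"
    unfolding G_N by (rule assoc_mult_mat) (use N Sr_diag in auto)
  then have "mat_rank G \<le> mat_rank N"
    using mat_rank_mult_le[OF N, of "Sr * N\<^sup>T" n] N Sr_diag by simp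
  also have "\<dots> \<le> r" using vec_space.rank_le_nc[OF N] N by simp
  finally have "mat_rank G \<le> r" .
  moreover have "frobenius_norm (A - G) \<le> frobenius_norm (A - G')"
    if "G' \<in> carrier_mat n n" "mat_rank G' \<le> r" for G'
    unfolding A_eq G_eq by (rule eckart_young[OF U UTU S desc_sq assms(1) S'_def that])
  ultimately have "best_rank_approx r A G"
    using A G_car unfolding best_rank_approx_def by simp
  then show ?thesis unfolding A_def X_def .
qed

end
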